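(* The set of positive integers $n$ such that $e(n) = e(n+1) = e(n+2)$ equals $$\{2^{2k+1} n + p_k \mid k, n \in \mathbb{N}_+,\ k \geq 2\} \cup \{2p_k - 1 \mid k \in \mathbb{N},\ k \geq 2\} \cup \{2^{2k+1} n + q_k - 1 \mid k, n \in \mathbb{N},\ k \geq 2\}.$$
   Context: $\mathbb{N}$ denotes the set of non-negative integers and $\mathbb{N}_+$ the set of positive integers. The Stern polynomials $B_n(t) \in \mathbb{Z}[t]$, $n \geq 0$, are defined by $B_0(t) = 0$, $B_1(t) = 1$, and for $n \geq 2$: $B_n(t) = t\,B_{n/2}(t)$ if $n$ is even, and $B_n(t) = B_{(n+1)/2}(t) + B_{(n-1)/2}(t)$ if $n$ is odd. For $n \geq 1$, $e(n) = \deg B_n(t)$. For $n \geq 0$, $p_n = \frac{4^n - 1}{3}$ and $q_n = \frac{5 \cdot 4^n - 2}{3}$. *)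

theory Defs
  imports "HOL-Computational_Algebra.Polynomial"
begin

function stern_poly :: "nat \<Rightarrow> int poly" where
  "stern_poly n =
     (if n = 0 then 0
      else if n = 1 then 1
      else if even n then [:0, 1:] * stern_poly (n div 2)
      else stern_poly ((n + 1) div 2) + stern_poly ((n - 1) div 2))"
  by pat_completeness auto
termination
  by (relation "measure id") (auto elim!: oddE)

declare stern_poly.simps [simp del]

text \<open>Only used for \<open>n \<ge> 1\<close>; at \<open>n = 0\<close> the polynomial is zero and the
  library's \<open>degree\<close> returns 0.\<close>
definition stern_deg :: "nat \<Rightarrow> nat" where
  "stern_deg n = degree (stern_poly n)"

text \<open>The divisions and subtractions on \<open>nat\<close> below are exact; see \<open>p_seq_exact\<close> and
  \<open>q_seq_exact\<close>.\<close>
definition p_seq :: "nat \<Rightarrow> nat" where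
  "p_seq n = (4 ^ n - 1) div 3"

definition q_seq :: "nat \<Rightarrow> nat" where
  "q_seq n = (5 * 4 ^ n - 2) div 3"

lemma p_seq_exact: "3 * p_seq n + 1 = 4 ^ n"
proof -
  have "\<exists>m. (4::nat) ^ n = 3 * m + 1"
  proof (induction n)
    case (Suc n)
    then obtain m where "(4::nat) ^ n = 3 * m + 1" by blast
    then have "(4::nat) ^ Suc n = 3 * (4 * m + 1) + 1" by simp
    then show ?case by blast
  qed simp
  then show ?thesis by (auto simp: p_seq_def)
qed

lemma q_seq_exact: "3 * q_seq n + 2 = 5 * 4 ^ n"
proof -
  have "5 * (4::nat) ^ n - 2 = 3 * (5 * p_seq n + 1)"
    using p_seq_exact[of n] by simp
  then show ?thesis
    using p_seq_exact[of n] by (simp add: q_seq_def)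
qed

end

theory Submission
  imports Defs
begin

text \<open>
  The coefficients of Stern polynomials are nonnegative, so no cancellation occurs in
  the sum that defines \<open>B\<^bsub>2n+1\<^esub>\<close>, and the degrees satisfy \<open>e(2n) = e(n) + 1\<close> and
  \<open>e(2n+1) = max (e(n)) (e(n+1))\<close>. For the increments \<open>d(n) = e(n+1) - e(n)\<close> this gives
  \<open>d(2n) = max 0 (d(n)) - 1\<close> when \<open>n > 0\<close>, and \<open>d(2n+1) = min 0 (d(n)) + 1\<close>. Hence \<open>d\<close>
  takes only the values -1, 0 and 1 and is computed by a three-state automaton that
  reads the binary digits of its argument.

  Running the automaton backwards from two consecutive zeros \<open>d(n) = d(n+1) = 0\<close> shows
  that they occur exactly when either \<open>n = 16i + 5\<close> with \<open>i > 0\<close> and \<open>d(i) \<le> 0\<close>, or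
  \<open>n = 16i + 9\<close> with \<open>d(i) \<ge> 0\<close> (lemma \<open>constant_triple_iff\<close>).

  Each sign condition reproduces itself along one affine map. The condition \<open>d(i) \<ge> 0\<close>
  holds at \<open>0\<close> and at every odd number, holds at \<open>4m + 2\<close> exactly when it
  holds at \<open>m\<close>, and fails at the positive multiples of 4. Among positive \<open>i\<close>, the
  condition \<open>d(i) \<le> 0\<close> holds at every even number, holds at \<open>4m + 1\<close> with \<open>m > 0\<close> exactly
  when it holds at \<open>m\<close>, and fails at 1 and at every \<open>4m + 3\<close>. Since the
  \<open>k\<close>-th iterate of \<open>m \<mapsto> 4m + c\<close> is \<open>r \<mapsto> 4\<^sup>k r + c p\<^sub>k\<close>, the seeds
  determine both sets. The condition \<open>d(i) \<le> 0\<close> yields the family with \<open>p\<^sub>k\<close> from the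
  positive even seeds. The condition \<open>d(i) \<ge> 0\<close> yields \<open>2p\<^sub>k - 1\<close> from the seed \<open>0\<close>, and
  the family with \<open>q\<^sub>k\<close> from the odd seeds, because \<open>q\<^sub>k = 4\<^sup>k + 2p\<^sub>k\<close>.
\<close>

section \<open>Degrees of Stern polynomials\<close>

lemma degree_add_nonneg_coeffs:
  fixes p q :: "'a::ordered_comm_monoid_add poly"
  assumes "\<And>i. coeff p i \<ge> 0" and "\<And>i. coeff q i \<ge> 0"
  shows "degree (p + q) = max (degree p) (degree q)"
proof (rule antisym)
  show "degree (p + q) \<le> max (degree p) (degree q)"
    by (rule degree_add_le_max)
  have "coeff (p + q) i = 0 \<longleftrightarrow> coeff p i = 0 \<and> coeff q i = 0" for i
    using assms by (simp add: add_nonneg_eq_0_iff)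
  then show "max (degree p) (degree q) \<le> degree (p + q)"
    by (metis coeff_eq_0 degree_le linorder_not_le max.bounded_iff)
qed

lemma stern_poly_0 [simp]: "stern_poly 0 = 0"
  by (simp add: stern_poly.simps)

lemma stern_poly_1 [simp]: "stern_poly (Suc 0) = 1"
  by (simp add: stern_poly.simps)

lemma stern_poly_double: "stern_poly (2 * n) = pCons 0 (stern_poly n)"
  by (cases "n = 0") (simp_all add: stern_poly.simps[of "2 * n"])

lemma stern_poly_double_Suc:
  "stern_poly (2 * n + 1) = stern_poly (Suc n) + stern_poly n"
  by (cases "n = 0") (simp_all add: stern_poly.simps[of "Suc (2 * n)"])

lemma nat_parity_cases:
  obtains "n = 0" | "n = 1" | m :: nat where "n = 2 * m" "m > 0"
    | m where "n = 2 * m + 1" "m > 0"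
  by (metis add_0 evenE gr0I mult_0_right oddE)

lemma coeff_stern_poly_nonneg: "coeff (stern_poly n) i \<ge> 0"
proof (induction n arbitrary: i rule: less_induct)
  case (less n)
  show ?case
    by (cases n rule: nat_parity_cases)
      (use less in \<open>auto simp: stern_poly_double stern_poly_double_Suc coeff_pCons
         stern_poly_1[folded One_nat_def] simp del: One_nat_def split: nat.split\<close>)
qed

lemma stern_poly_nonzero: "n > 0 \<Longrightarrow> stern_poly n \<noteq> 0"
proof (induction n rule: less_induct)
  case (less n)
  show ?case
  proof (cases n rule: nat_parity_cases)
    case (4 m)
    then have "stern_poly m \<noteq> 0"
      using less by simp
    then obtain i where "coeff (stern_poly m) i \<noteq> 0"
      by (metis leading_coeff_0_iff)
    then have "coeff (stern_poly (Suc m) + stern_poly m) i \<noteq> 0"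
      by (simp add: add_nonneg_eq_0_iff coeff_stern_poly_nonneg)
    then show ?thesis
      using 4 by (metis coeff_0 stern_poly_double_Suc)
  qed (use less in \<open>simp_all add: stern_poly_double\<close>)
qed

lemma stern_deg_double: "n > 0 \<Longrightarrow> stern_deg (2 * n) = stern_deg n + 1"
  by (simp add: stern_deg_def stern_poly_double stern_poly_nonzero)

lemma stern_deg_double_Suc:
  "stern_deg (2 * n + 1) = max (stern_deg n) (stern_deg (Suc n))"
  unfolding stern_deg_def stern_poly_double_Suc
  by (simp add: degree_add_nonneg_coeffs coeff_stern_poly_nonneg max.commute)

section \<open>Increments of the degree\<close>

definition stern_deg_diff :: "nat \<Rightarrow> int" where
  "stern_deg_diff n = int (stern_deg (Suc n)) - int (stern_deg n)"

lemma stern_deg_diff_0: "stern_deg_diff 0 = 0"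
  by (simp add: stern_deg_diff_def stern_deg_def)

lemma stern_deg_diff_double:
  "n > 0 \<Longrightarrow> stern_deg_diff (2 * n) = max 0 (stern_deg_diff n) - 1"
  using stern_deg_double[of n] stern_deg_double_Suc[of n]
  by (simp add: stern_deg_diff_def)

lemma stern_deg_diff_double_Suc:
  "stern_deg_diff (2 * n + 1) = min 0 (stern_deg_diff n) + 1"
  using stern_deg_double[of "Suc n"] stern_deg_double_Suc[of n]
  by (simp add: stern_deg_diff_def)

lemma stern_deg_diff_1: "stern_deg_diff 1 = 1"
  using stern_deg_diff_double_Suc[of 0] by (simp add: stern_deg_diff_0)

lemma stern_deg_diff_bounds: "- 1 \<le> stern_deg_diff n \<and> stern_deg_diff n \<le> 1"
proof (induction n rule: less_induct)
  case (less n)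
  show ?case
  proof (cases n rule: nat_parity_cases)
    case (3 m)
    then show ?thesis
      using less[of m] stern_deg_diff_double[of m] by simp
  next
    case (4 m)
    then show ?thesis
      using less[of m] stern_deg_diff_double_Suc[of m] by (simp add: min_def)
  qed (use stern_deg_diff_0 stern_deg_diff_1 in simp_all)
qed

text \<open>
  Two steps of the automaton, that is, one base-4 digit. For \<open>m > 0\<close>, the increment at
  \<open>4m\<close> and \<open>4m + 3\<close> is determined by the last digit; the other two digits pass on
  information about \<open>m\<close>.
\<close>

lemma stern_deg_diff_mod4:
  shows "m > 0 \<Longrightarrow> stern_deg_diff (4 * m) = - 1"
    and "m > 0 \<Longrightarrow> stern_deg_diff (4 * m + 1) = (if stern_deg_diff m \<le> 0 then 0 else 1)"
    and "stern_deg_diff (4 * m + 2) = (if stern_deg_diff m \<ge> 0 then 0 else - 1)"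
    and "stern_deg_diff (4 * m + 3) = 1"
proof -
  note b = stern_deg_diff_bounds[of m]
  have 1: "stern_deg_diff (2 * m + 1) = min 0 (stern_deg_diff m) + 1"
    by (rule stern_deg_diff_double_Suc)
  show "stern_deg_diff (4 * m + 2) = (if stern_deg_diff m \<ge> 0 then 0 else - 1)"
    using b 1 stern_deg_diff_double[of "2 * m + 1"] by simp
  show "stern_deg_diff (4 * m + 3) = 1"
    using b 1 stern_deg_diff_double_Suc[of "2 * m + 1"] by (simp add: numeral_3_eq_3 min_def)
  assume "m > 0"
  then have 0: "stern_deg_diff (2 * m) = max 0 (stern_deg_diff m) - 1"
    by (rule stern_deg_diff_double)
  show "stern_deg_diff (4 * m) = - 1"
    using b 0 stern_deg_diff_double[of "2 * m"] \<open>m > 0\<close> by simp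
  show "stern_deg_diff (4 * m + 1) = (if stern_deg_diff m \<le> 0 then 0 else 1)"
    using b 0 stern_deg_diff_double_Suc[of "2 * m"] by simp
qed

lemma nat_mod4_cases:
  obtains m :: nat where "n = 4 * m" | m where "n = 4 * m + 1"
    | m where "n = 4 * m + 2" | m where "n = 4 * m + 3"
proof -
  have "n mod 4 = 0 \<or> n mod 4 = 1 \<or> n mod 4 = 2 \<or> n mod 4 = 3"
    by linarith
  then show thesis
    using that by (metis add.right_neutral mult_div_mod_eq)
qed

lemma four_mult_neq:
  fixes i m :: nat
  shows "4 * m \<noteq> Suc (4 * i)" and "Suc (4 * i) \<noteq> 4 * m"
    and "4 * m \<noteq> Suc (Suc (4 * i))" and "Suc (Suc (4 * i)) \<noteq> 4 * m"
  by presburger+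

section \<open>The sign of the increment\<close>

lemma p_seq_0: "p_seq 0 = 0"
  using p_seq_exact[of 0] by simp

lemma p_seq_Suc: "p_seq (Suc k) = 4 * p_seq k + 1"
  using p_seq_exact[of k] p_seq_exact[of "Suc k"] by simp

lemma q_seq_eq_p_seq: "q_seq k = 4 ^ k + 2 * p_seq k"
  using p_seq_exact[of k] q_seq_exact[of k] by simp

text \<open>
  The \<open>k\<close>-th iterate of \<open>m \<mapsto> 4m + c\<close> adds \<open>c (1 + 4 + \<dots> + 4\<^sup>k\<^sup>-\<^sup>1) = c p\<^sub>k\<close> to \<open>4\<^sup>k r\<close>.
  The predicate \<open>P\<close> is generated from the seeds \<open>Q\<close> by this map. Positivity of \<open>c\<close> makes the recursion well-founded even at 0.
\<close>

lemma affine_recursion_iff: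
  fixes P Q :: "nat \<Rightarrow> bool" and c :: nat
  assumes "c > 0" and rec: "\<And>n. P n \<longleftrightarrow> Q n \<or> (\<exists>m. n = 4 * m + c \<and> P m)"
  shows "P n \<longleftrightarrow> (\<exists>k r. Q r \<and> n = 4 ^ k * r + c * p_seq k)"
proof
  show "P n \<Longrightarrow> \<exists>k r. Q r \<and> n = 4 ^ k * r + c * p_seq k"
  proof (induction n rule: less_induct)
    case (less n)
    from less.prems consider "Q n" | m where "n = 4 * m + c" "P m"
      using rec by blast
    then show ?case
    proof cases
      case 1
      then have "Q n \<and> n = 4 ^ 0 * n + c * p_seq 0"
        by (simp add: p_seq_0)
      then show ?thesis by blast
    next
      case (2 m)
      then obtain k r where "Q r" "m = 4 ^ k * r + c * p_seq k"
        using less.IH[of m] \<open>c > 0\<close> by auto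
      then have "Q r \<and> n = 4 ^ Suc k * r + c * p_seq (Suc k)"
        using 2 by (simp add: p_seq_Suc algebra_simps)
      then show ?thesis by blast
    qed
  qed
next
  have "P (4 ^ k * r + c * p_seq k)" if "Q r" for k r
  proof (induction k)
    case 0
    then show ?case
      using that rec[of r] by (simp add: p_seq_0)
  next
    case (Suc k)
    moreover have "4 ^ Suc k * r + c * p_seq (Suc k) = 4 * (4 ^ k * r + c * p_seq k) + c"
      by (simp add: p_seq_Suc algebra_simps)
    ultimately show ?case
      using rec[of "4 ^ Suc k * r + c * p_seq (Suc k)"] by blast
  qed
  then show "\<exists>k r. Q r \<and> n = 4 ^ k * r + c * p_seq k \<Longrightarrow> P n"
    by blast
qed

lemma stern_deg_diff_nonneg_iff:
  "stern_deg_diff n \<ge> 0 \<longleftrightarrow>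
     (\<exists>k. n = 2 * p_seq k) \<or> (\<exists>k m. n = 2 * 4 ^ k * m + q_seq k)"
proof -
  have "stern_deg_diff n \<ge> 0 \<longleftrightarrow>
      (\<exists>k r. (r = 0 \<or> odd r) \<and> n = 4 ^ k * r + 2 * p_seq k)"
  proof (rule affine_recursion_iff)
    fix n
    show "stern_deg_diff n \<ge> 0 \<longleftrightarrow>
      (n = 0 \<or> odd n) \<or> (\<exists>m. n = 4 * m + 2 \<and> stern_deg_diff m \<ge> 0)"
    proof (cases n rule: nat_mod4_cases)
      case (1 m)
      then show ?thesis
        using stern_deg_diff_mod4(1)[of m]
        by (cases "m = 0") (auto simp: stern_deg_diff_0 four_mult_neq)
    next
      case (2 m)
      then show ?thesis
        using stern_deg_diff_double_Suc[of "2 * m"] stern_deg_diff_bounds[of "2 * m"]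
        by (simp add: min_def)
    next
      case (3 m)
      then show ?thesis
        using stern_deg_diff_mod4(3)[of m] by auto
    next
      case (4 m)
      then show ?thesis
        using stern_deg_diff_mod4(4)[of m] by simp
    qed
  qed simp
  also have "\<dots> \<longleftrightarrow>
      (\<exists>k. n = 2 * p_seq k) \<or> (\<exists>k m. n = 4 ^ k * (2 * m + 1) + 2 * p_seq k)"
  proof -
    have "(\<exists>r. (r = 0 \<or> odd r) \<and> n = 4 ^ k * r + 2 * p_seq k) \<longleftrightarrow>
        n = 2 * p_seq k \<or> (\<exists>m. n = 4 ^ k * (2 * m + 1) + 2 * p_seq k)" for k
      by (metis add_0 even_plus_one_iff mult_0_right oddE
          dvd_triv_left)
    then show ?thesis by blast
  qed
  also have "\<dots> \<longleftrightarrow> (\<exists>k. n = 2 * p_seq k) \<or> (\<exists>k m. n = 2 * 4 ^ k * m + q_seq k)"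
    by (simp add: q_seq_eq_p_seq algebra_simps)
  finally show ?thesis .
qed

lemma stern_deg_diff_nonpos_iff:
  "n > 0 \<and> stern_deg_diff n \<le> 0 \<longleftrightarrow>
     (\<exists>k m. m > 0 \<and> n = 2 * 4 ^ k * m + p_seq k)"
proof -
  have "n > 0 \<and> stern_deg_diff n \<le> 0 \<longleftrightarrow>
      (\<exists>k r. (r > 0 \<and> even r) \<and> n = 4 ^ k * r + 1 * p_seq k)"
  proof (rule affine_recursion_iff)
    fix n
    show "n > 0 \<and> stern_deg_diff n \<le> 0 \<longleftrightarrow>
      (n > 0 \<and> even n) \<or> (\<exists>m. n = 4 * m + 1 \<and> m > 0 \<and> stern_deg_diff m \<le> 0)"
    proof (cases n rule: nat_mod4_cases)
      case (1 m)
      then show ?thesis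
        using stern_deg_diff_mod4(1)[of m] by (cases "m = 0") (auto simp: four_mult_neq)
    next
      case (2 m)
      then show ?thesis
        using stern_deg_diff_mod4(2)[of m] stern_deg_diff_1 by (cases "m = 0") auto
    next
      case (3 m)
      then show ?thesis
        using stern_deg_diff_mod4(3)[of m] by auto
    next
      case (4 m)
      then have "odd n" and "n \<noteq> 4 * i + 1" for i
        by presburger+
      then show ?thesis
        using 4 stern_deg_diff_mod4(4)[of m] by simp
    qed
  qed simp
  also have "\<dots> \<longleftrightarrow> (\<exists>k m. m > 0 \<and> n = 2 * 4 ^ k * m + p_seq k)" (is "?L = ?R")
  proof
    assume ?L
    then obtain k m where "n = 4 ^ k * (2 * m) + 1 * p_seq k" "m > 0"
      by (auto elim!: evenE)
    then have "m > 0 \<and> n = 2 * 4 ^ k * m + p_seq k"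
      by simp
    then show ?R by blast
  next
    assume ?R
    then obtain k m where "n = 2 * 4 ^ k * m + p_seq k" "m > 0"
      by blast
    then have "(2 * m > 0 \<and> even (2 * m)) \<and> n = 4 ^ k * (2 * m) + 1 * p_seq k"
      by simp
    then show ?L by blast
  qed
  finally show ?thesis .
qed

section \<open>Three consecutive equal degrees\<close>

text \<open>
  At positive arguments \<open>d\<close> vanishes only in the residue classes 1 and 2 modulo 4, so two
  consecutive zeros must be at \<open>4j + 1\<close> and \<open>4j + 2\<close>. The first needs \<open>d(j) \<le> 0\<close>, the
  second \<open>d(j) \<ge> 0\<close>.
\<close>

lemma constant_triple_iff_diff:
  "n > 0 \<and> stern_deg n = stern_deg (n + 1) \<and> stern_deg (n + 1) = stern_deg (n + 2) \<longleftrightarrow>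
     (\<exists>j. n = 4 * j + 1 \<and> j > 0 \<and> stern_deg_diff j = 0)"
proof -
  have *: "stern_deg n = stern_deg (n + 1) \<and> stern_deg (n + 1) = stern_deg (n + 2) \<longleftrightarrow>
    stern_deg_diff n = 0 \<and> stern_deg_diff (n + 1) = 0"
    by (auto simp: stern_deg_diff_def)
  show ?thesis
  proof (cases n rule: nat_mod4_cases)
    case (1 m)
    then show ?thesis
      unfolding * using stern_deg_diff_mod4(1)[of m] by (auto simp: four_mult_neq)
  next
    case (2 m)
    then show ?thesis
      unfolding * using stern_deg_diff_mod4(2,3)[of m] stern_deg_diff_1
      by (cases "m = 0") auto
  next
    case (3 m)
    then have "n \<noteq> 4 * i + 1" for i
      by presburger
    then show ?thesis
      unfolding * using 3 stern_deg_diff_mod4(4)[of m] by (simp add: numeral_3_eq_3)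
  next
    case (4 m)
    then have "n \<noteq> 4 * i + 1" for i
      by presburger
    then show ?thesis
      unfolding * using 4 stern_deg_diff_mod4(4)[of m] by simp
  qed
qed

lemma stern_deg_diff_eq_0_iff:
  "j > 0 \<and> stern_deg_diff j = 0 \<longleftrightarrow>
     (\<exists>i. j = 4 * i + 1 \<and> i > 0 \<and> stern_deg_diff i \<le> 0) \<or>
     (\<exists>i. j = 4 * i + 2 \<and> stern_deg_diff i \<ge> 0)"
proof (cases j rule: nat_mod4_cases)
  case (1 m)
  then show ?thesis
    using stern_deg_diff_mod4(1)[of m] by (auto simp: four_mult_neq)
next
  case (2 m)
  then show ?thesis
    using stern_deg_diff_mod4(2)[of m] stern_deg_diff_1
    by (cases "m = 0") (auto simp: four_mult_neq)
next
  case (3 m)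
  then show ?thesis
    using stern_deg_diff_mod4(3)[of m] by (auto simp: four_mult_neq)
next
  case (4 m)
  then have "j \<noteq> 4 * i + 1" and "j \<noteq> 4 * i + 2" for i
    by presburger+
  then show ?thesis
    using 4 stern_deg_diff_mod4(4)[of m] by simp
qed

lemma constant_triple_iff:
  "n > 0 \<and> stern_deg n = stern_deg (n + 1) \<and> stern_deg (n + 1) = stern_deg (n + 2) \<longleftrightarrow>
     (\<exists>i. n = 16 * i + 5 \<and> i > 0 \<and> stern_deg_diff i \<le> 0) \<or>
     (\<exists>i. n = 16 * i + 9 \<and> stern_deg_diff i \<ge> 0)"
proof -
  have "n = 16 * i + 5 \<longleftrightarrow> n = 4 * (4 * i + 1) + 1"
    and "n = 16 * i + 9 \<longleftrightarrow> n = 4 * (4 * i + 2) + 1" for i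
    by auto
  then show ?thesis
    unfolding constant_triple_iff_diff stern_deg_diff_eq_0_iff by metis
qed

lemma nat_ge_2_iff: "(k::nat) \<ge> 2 \<longleftrightarrow> (\<exists>l. k = l + 2)"
  using le_Suc_ex[of 2 k] by (auto simp: add.commute)

theorem theorem3p2:
  shows "{n :: nat. n > 0 \<and> stern_deg n = stern_deg (n + 1)
            \<and> stern_deg (n + 1) = stern_deg (n + 2)}
       = {2 ^ (2 * k + 1) * n + p_seq k | k n :: nat. k > 0 \<and> n > 0 \<and> k \<ge> 2}
       \<union> {2 * p_seq k - 1 | k :: nat. k \<ge> 2}
       \<union> {2 ^ (2 * k + 1) * n + q_seq k - 1 | k n :: nat. k \<ge> 2}"
proof -
  have pow: "(2::nat) ^ (2 * k + 1) = 2 * 4 ^ k" for k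
    by (simp add: power_mult)
  have p: "p_seq (l + 2) = 16 * p_seq l + 5" for l
    by (simp add: p_seq_Suc)
  \<comment> \<open>The index \<open>k\<close> exceeds the number \<open>l\<close> of iterations that lead to \<open>i\<close> by two,
    because \<open>n\<close> has two base-4 digits more than \<open>i\<close>.\<close>
  have A: "(\<exists>i. n = 16 * i + 5 \<and> i > 0 \<and> stern_deg_diff i \<le> 0) \<longleftrightarrow>
      (\<exists>k m. n = 2 ^ (2 * k + 1) * m + p_seq k \<and> k > 0 \<and> m > 0 \<and> k \<ge> 2)" for n
  proof -
    have "(\<exists>i. n = 16 * i + 5 \<and> i > 0 \<and> stern_deg_diff i \<le> 0) \<longleftrightarrow>
        (\<exists>l m. m > 0 \<and> n = 16 * (2 * 4 ^ l * m + p_seq l) + 5)"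
      unfolding stern_deg_diff_nonpos_iff by blast
    also have "\<dots> \<longleftrightarrow>
        (\<exists>l m. m > 0 \<and> n = 2 ^ (2 * (l + 2) + 1) * m + p_seq (l + 2))"
      unfolding pow p by (simp add: algebra_simps)
    also have "\<dots> \<longleftrightarrow>
        (\<exists>k m. n = 2 ^ (2 * k + 1) * m + p_seq k \<and> k > 0 \<and> m > 0 \<and> k \<ge> 2)"
      unfolding nat_ge_2_iff by (metis add_gr_0 zero_less_numeral)
    finally show ?thesis .
  qed
  have B: "(\<exists>i. n = 16 * i + 9 \<and> stern_deg_diff i \<ge> 0) \<longleftrightarrow>
      (\<exists>k. n = 2 * p_seq k - 1 \<and> k \<ge> 2) \<or>
      (\<exists>k m. n = 2 ^ (2 * k + 1) * m + q_seq k - 1 \<and> k \<ge> 2)" for n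
  proof -
    have "(\<exists>i. n = 16 * i + 9 \<and> stern_deg_diff i \<ge> 0) \<longleftrightarrow>
        (\<exists>l. n = 16 * (2 * p_seq l) + 9) \<or>
        (\<exists>l m. n = 16 * (2 * 4 ^ l * m + q_seq l) + 9)"
      unfolding stern_deg_diff_nonneg_iff by blast
    also have "\<dots> \<longleftrightarrow>
        (\<exists>l. n = 2 * p_seq (l + 2) - 1) \<or>
        (\<exists>l m. n = 2 ^ (2 * (l + 2) + 1) * m + q_seq (l + 2) - 1)"
      unfolding pow q_seq_eq_p_seq p by (simp add: algebra_simps)
    also have "\<dots> \<longleftrightarrow>
        (\<exists>k. n = 2 * p_seq k - 1 \<and> k \<ge> 2) \<or>
        (\<exists>k m. n = 2 ^ (2 * k + 1) * m + q_seq k - 1 \<and> k \<ge> 2)"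
      unfolding nat_ge_2_iff by metis
    finally show ?thesis .
  qed
  show ?thesis
    unfolding constant_triple_iff A B by (simp add: set_eq_iff)
qed

end
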